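(* Let $\sigma\in\mathrm{Aut}(G)$. Then for every subgroup $H$ of finite index in $G$ we have $c(\sigma(H))=c(H)$.
   Context: Let $\mathbb{F}_q$ be a finite field, $K$ an algebraic function field in one variable with constant field $\mathbb{F}_q$, $\infty$ a fixed place of $K$, and $A$ the ring of elements of $K$ integral at every place other than $\infty$. Let $G=GL_2(A)$ act on $\widehat{K}=\mathbb{P}^1(K)=K\cup\{\infty\}$ by Möbius transformations. For a finite index subgroup $H$ of $G$, $\mathrm{Cusp}(H)=H\backslash\widehat{K}$ is the (finite) set of $H$-orbits on $\widehat{K}$ and $c(H)=|\mathrm{Cusp}(H)|$. *)

theory Defs
  imports
    "HOL-Algebra.Algebra"
    "HOL-Algebra.Algebraic_Closure_Type"
    "HOL-Analysis.Finite_Cartesian_Product"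
begin

(* The function field K is the universe of a type 'k of class field, and its constant field is
   a subset F of 'k.  The notions of HOL-Algebra apply to K through ring_of_type_algebra. *)
definition algebraic_function_field :: "'k::field set \<Rightarrow> bool" where
  "algebraic_function_field F \<longleftrightarrow>
     (let K = (ring_of_type_algebra :: 'k ring) in
        subfield F K \<and>
        (\<exists>x. ring.transcendental K F x \<and>
             ring.finite_dimension K (generate_field K (insert x F)) UNIV))"

definition full_constant_field :: "'k::field set \<Rightarrow> bool" where
  "full_constant_field F \<longleftrightarrow>
     (\<forall>x. ring.algebraic (ring_of_type_algebra :: 'k ring) F x \<longrightarrow> x \<in> F)"

definition valuation_ring :: "'k::field set \<Rightarrow> 'k set \<Rightarrow> bool" where
  "valuation_ring F R \<longleftrightarrow>
     subring R (ring_of_type_algebra :: 'k ring) \<and> F \<subset> R \<and> R \<subset> UNIV \<and>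
     (\<forall>z. z \<noteq> 0 \<longrightarrow> z \<in> R \<or> inverse z \<in> R)"

(* As in Stichtenoth, a place is the maximal ideal (the set of non-units) of a valuation ring
   of K/F; the ring is recovered from the place by place_ring. *)
definition place :: "'k::field set \<Rightarrow> 'k set \<Rightarrow> bool" where
  "place F P \<longleftrightarrow> (\<exists>R. valuation_ring F R \<and> P = {z \<in> R. z = 0 \<or> inverse z \<notin> R})"

definition place_ring :: "'k::field set \<Rightarrow> 'k set" where
  "place_ring P = {z. z = 0 \<or> inverse z \<notin> P}"

lemma place_ring_eq:
  assumes "valuation_ring F R"
  shows "place_ring {z \<in> R. z = 0 \<or> inverse z \<notin> R} = R"
proof -
  have "subring R (ring_of_type_algebra :: 'a ring)"
    using assms unfolding valuation_ring_def by blast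
  from subringE(2)[OF this] have "0 \<in> R"
    by (simp add: ring_of_type_algebra_def)
  have "z \<in> R" if "inverse z \<notin> R" for z
  proof (cases "z = 0")
    case False
    with assms that show ?thesis
      unfolding valuation_ring_def by blast
  qed (use \<open>0 \<in> R\<close> in simp)
  with \<open>0 \<in> R\<close> show ?thesis
    by (fastforce simp: place_ring_def)
qed

(* P\<^sub>0 is the distinguished place of K usually written \<infinity>. *)
definition integers_outside :: "'k::field set \<Rightarrow> 'k set \<Rightarrow> 'k set" where
  "integers_outside F P\<^sub>0 = {x. \<forall>P. place F P \<and> P \<noteq> P\<^sub>0 \<longrightarrow> x \<in> place_ring P}"

definition M2 :: "'k::field set \<Rightarrow> ('k^2^2) monoid" where
  "M2 A = \<lparr>carrier = {M. \<forall>i j. M $ i $ j \<in> A}, monoid.mult = (**), one = mat 1\<rparr>"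

definition GL2 :: "'k::field set \<Rightarrow> ('k^2^2) monoid" where
  "GL2 A = units_of (M2 A)"

(* The projective line K \<union> {\<infinity>} is the type 'k option, with None as the point at infinity. *)
definition moebius :: "'k::field^2^2 \<Rightarrow> 'k option \<Rightarrow> 'k option" where
  "moebius M s =
     (let a = M $ 1 $ 1; b = M $ 1 $ 2; c = M $ 2 $ 1; d = M $ 2 $ 2 in
      case s of
        None \<Rightarrow> if c = 0 then None else Some (a / c)
      | Some z \<Rightarrow> if c * z + d = 0 then None else Some ((a * z + b) / (c * z + d)))"

definition Cusp :: "'k::field set \<Rightarrow> ('k^2^2) set \<Rightarrow> 'k option set set" where
  "Cusp A H = orbits ((GL2 A)\<lparr>carrier := H\<rparr>) UNIV moebius"

(* For H of finite index, Cusp A H is finite, so that card is its true cardinality. *)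
definition cusp_number :: "'k::field set \<Rightarrow> ('k^2^2) set \<Rightarrow> nat" where
  "cusp_number A H = card (Cusp A H)"

end

theory Submission
  imports Defs "HOL-Analysis.Cartesian_Space"
begin

text \<open>Let \<open>p\<close> be the characteristic of \<open>K\<close>.  An element \<open>u\<close> of \<open>G\<close> satisfies \<open>u\<^sup>p = 1\<close> iff it is
  unipotent, a unipotent \<open>u \<noteq> 1\<close> fixes exactly one point of the projective line, and two such
  elements commute iff they fix the same point.  As \<open>K\<close> is the field of fractions of \<open>A\<close>, every point
  is fixed by such an element of \<open>G\<close>.  All this is visible to the abstract group, so an automorphism
  \<open>\<sigma>\<close> induces a bijection \<open>\<tau>\<close> of the projective line with \<open>\<tau> (g s) = \<sigma> g (\<tau> s)\<close>, which carries
  the \<open>H\<close>-orbits to the \<open>\<sigma>(H)\<close>-orbits.\<close>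

(* In Defs the symbol $ is ambiguous between vec_nth and fps_nth; each doubly indexed matrix entry
   multiplies the number of parses. *)
unbundle no Formal_Power_Series.fps_syntax


section \<open>Two-by-two matrices\<close>

definition mat2 :: "'k \<Rightarrow> 'k \<Rightarrow> 'k \<Rightarrow> 'k \<Rightarrow> 'k^2^2" where
  "mat2 a b c d = (\<chi> i j. if i = 1 then (if j = 1 then a else b) else (if j = 1 then c else d))"

lemma mat2_nth [simp]:
  "mat2 a b c d $ 1 $ 1 = a" "mat2 a b c d $ 1 $ 2 = b"
  "mat2 a b c d $ 2 $ 1 = c" "mat2 a b c d $ 2 $ 2 = d"
  by (simp_all add: mat2_def)

lemma mat2_eq_iff:
  "M = N \<longleftrightarrow> M $ 1 $ 1 = N $ 1 $ 1 \<and> M $ 1 $ 2 = N $ 1 $ 2 \<and> M $ 2 $ 1 = N $ 2 $ 1 \<and> M $ 2 $ 2 = N $ 2 $ 2"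
  for M N :: "'k^2^2"
  by (auto simp: vec_eq_iff forall_2)

lemma mat2_cases:
  fixes M :: "'k^2^2"
  obtains a b c d where "M = mat2 a b c d"
  by (metis mat2_eq_iff mat2_nth)

lemma mat2_mult:
  fixes a b c d :: "'k::semiring_1"
  shows "mat2 a b c d ** mat2 a' b' c' d' =
    mat2 (a * a' + b * c') (a * b' + b * d') (c * a' + d * c') (c * b' + d * d')"
  by (simp add: mat2_eq_iff matrix_matrix_mult_def sum_2)

lemma mat_1_eq_mat2: "(mat 1 :: 'k::semiring_1^2^2) = mat2 1 0 0 1"
  by (simp add: mat2_eq_iff mat_def)

lemma mat2_inject [simp]:
  "mat2 a b c d = mat2 a' b' c' d' \<longleftrightarrow> a = a' \<and> b = b' \<and> c = c' \<and> d = d'"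
  by (simp add: mat2_eq_iff)

definition det2 :: "'k::comm_ring_1^2^2 \<Rightarrow> 'k" where
  "det2 M = M $ 1 $ 1 * M $ 2 $ 2 - M $ 1 $ 2 * M $ 2 $ 1"

lemma det2_mult: "det2 (M ** N) = det2 M * det2 N"
  by (cases M rule: mat2_cases, cases N rule: mat2_cases)
     (simp add: mat2_mult det2_def algebra_simps)

lemma det2_mat_1 [simp]: "det2 (mat 1) = 1"
  by (simp add: det2_def mat_def)


section \<open>The action on the projective line\<close>

lemma moebius_mat_1 [simp]: "moebius (mat 1) s = s"
  by (cases s) (simp_all add: moebius_def mat_1_eq_mat2)

lemma moebius_mult:
  assumes "det2 M \<noteq> 0" "det2 N \<noteq> 0"
  shows "moebius (M ** N) s = moebius M (moebius N s)"
proof -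
  obtain a b c d where M: "M = mat2 a b c d" by (rule mat2_cases)
  obtain a' b' c' d' where N: "N = mat2 a' b' c' d'" by (rule mat2_cases)
  have dM: "a * d \<noteq> b * c" and dN: "a' * d' \<noteq> b' * c'"
    using assms by (auto simp: M N det2_def)
  \<comment> \<open>Homogeneous coordinates of the image of \<open>s\<close> under \<open>N\<close>,
    with \<open>None\<close> read as the vector (1, 0).\<close>
  define num den where "num = (case s of None \<Rightarrow> a' | Some z \<Rightarrow> a' * z + b')"
    and "den = (case s of None \<Rightarrow> c' | Some z \<Rightarrow> c' * z + d')"
  have nonzero: "num \<noteq> 0 \<or> den \<noteq> 0"
  proof (cases s)
    case None
    then show ?thesis using dN by (auto simp: num_def den_def)
  next
    case (Some z)
    have "a' * d' - b' * c' = a' * (c' * z + d') - c' * (a' * z + b')"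
      by (simp add: algebra_simps)
    then show ?thesis using dN Some by (auto simp: num_def den_def)
  qed
  have inner: "moebius N s = (if den = 0 then None else Some (num / den))"
    by (simp add: moebius_def N num_def den_def split: option.split)
  have expand: "(e * a' + f * c') * z + (e * b' + f * d') = e * (a' * z + b') + f * (c' * z + d')"
    for e f z by (simp add: algebra_simps)
  have outer: "moebius (M ** N) s =
      (if c * num + d * den = 0 then None else Some ((a * num + b * den) / (c * num + d * den)))"
    by (cases s) (simp_all only: moebius_def M N mat2_mult num_def den_def mat2_nth Let_def
      option.case expand)
  show ?thesis
  proof (cases "den = 0")
    case True
    then show ?thesis using nonzero by (simp add: inner outer) (simp add: moebius_def M)
  next
    case False
    have "c * (num / den) + d = (c * num + d * den) / den"
      "a * (num / den) + b = (a * num + b * den) / den"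
      using False by (simp_all add: field_simps)
    then show ?thesis using False by (simp add: inner outer) (simp add: moebius_def M)
  qed
qed


section \<open>Unipotent matrices\<close>

text \<open>Trace 2 and determinant 1 mean that the characteristic polynomial is (X - 1)^2. The
  identity is included.\<close>

definition unipotent2 :: "'k::comm_ring_1^2^2 \<Rightarrow> bool" where
  "unipotent2 u \<longleftrightarrow> u $ 1 $ 1 + u $ 2 $ 2 = 2 \<and> det2 u = 1"

text \<open>For unipotent \<open>u\<close>, the first column of \<open>u - mat 1\<close> spans the
  fixed line unless it is zero; then the fixed point is infinity. At \<open>mat 1\<close> the value
  \<open>None\<close> is only a default.\<close>

definition fixpoint :: "'k::field^2^2 \<Rightarrow> 'k option" where
  "fixpoint u = (if u $ 2 $ 1 = 0 then None else Some ((u $ 1 $ 1 - 1) / u $ 2 $ 1))"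

text \<open>With \<open>u = mat 1 + N\<close>, the trace condition makes N traceless and the
  relation says det N = 0, so N squares to zero.\<close>

lemma unipotent2E:
  fixes u :: "'k::comm_ring_1^2^2"
  assumes "unipotent2 u"
  obtains x y z where "u = mat2 (1 + x) y z (1 - x)" "x * x + y * z = 0"
proof -
  obtain a b c d where u: "u = mat2 a b c d" by (rule mat2_cases)
  have d: "d = 1 - (a - 1)" and "a * d - b * c = 1"
    using assms by (auto simp: unipotent2_def det2_def u algebra_simps)
  have "(a - 1) * (a - 1) + b * c = 1 - (a * (1 - (a - 1)) - b * c)" by (simp add: algebra_simps)
  also have "\<dots> = 0" using \<open>a * d - b * c = 1\<close> by (simp add: d[symmetric])
  finally show thesis using d by (intro that[of "a - 1" b c]) (simp_all add: u)
qed

lemma unipotent2_mat2: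
  fixes x y z :: "'k::comm_ring_1"
  assumes "x * x + y * z = 0"
  shows "unipotent2 (mat2 (1 + x) y z (1 - x))"
proof -
  have "(1 + x) * (1 - x) - y * z = 1 - (x * x + y * z)" by (simp add: algebra_simps)
  then show ?thesis using assms by (simp add: unipotent2_def det2_def)
qed

text \<open>The nonzero nilpotent matrix \<open>u - mat 1\<close> has a one-dimensional
  kernel.\<close>

lemma moebius_unipotent2_eq_iff:
  fixes u :: "'k::field^2^2"
  assumes "unipotent2 u" "u \<noteq> mat 1"
  shows "moebius u s = s \<longleftrightarrow> s = fixpoint u"
proof -
  obtain x y z where u: "u = mat2 (1 + x) y z (1 - x)" and *: "x * x + y * z = 0"
    using assms(1) by (rule unipotent2E)
  show ?thesis
  proof (cases "z = 0")
    case True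
    then have "x = 0" "y \<noteq> 0" using * assms(2) by (auto simp: u mat_1_eq_mat2)
    then show ?thesis using True
      by (cases s) (simp_all add: moebius_def fixpoint_def u)
  next
    case False
    have eq_iff: "z * w + (1 - x) \<noteq> 0 \<and> ((1 + x) * w + y) / (z * w + (1 - x)) = w \<longleftrightarrow> w = x / z" for w
    proof
      assume "w = x / z"
      then have "z * w = x" using False by simp
      moreover have "(1 + x) * w + y = w"
      proof -
        have "x * w + y = (x * x + y * z) / z"
          using False \<open>w = x / z\<close> by (simp add: field_simps)
        then show ?thesis using * by (simp add: algebra_simps)
      qed
      ultimately show "z * w + (1 - x) \<noteq> 0 \<and> ((1 + x) * w + y) / (z * w + (1 - x)) = w"
        by simp
    next
      assume "z * w + (1 - x) \<noteq> 0 \<and> ((1 + x) * w + y) / (z * w + (1 - x)) = w"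
      then have "(1 + x) * w + y = w * (z * w + (1 - x))"
        by (metis nonzero_divide_eq_eq)
      then have eq: "2 * x * w + y - z * w * w = 0" by (simp add: algebra_simps)
      \<comment> \<open>Multiplied by -z, the quadratic fixed point equation becomes a perfect
        square because \<open>x * x + y * z = 0\<close>. This covers characteristic 2 as
        well.\<close>
      have "(z * w - x) * (z * w - x) = (x * x + y * z) - z * (2 * x * w + y - z * w * w)"
        by (simp add: algebra_simps)
      then have "z * w = x" using * eq by simp
      then show "w = x / z" using False by (simp add: field_simps)
    qed
    have "fixpoint u = Some (x / z)" using False by (simp add: fixpoint_def u)
    moreover have "moebius u None \<noteq> None" using False by (simp add: moebius_def u)
    moreover have "moebius u (Some w) =
        (if z * w + (1 - x) = 0 then None else Some (((1 + x) * w + y) / (z * w + (1 - x))))" for w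
      by (simp only: moebius_def u mat2_nth Let_def option.case)
    ultimately show ?thesis using eq_iff by (cases s) (simp_all only: split: if_split, blast+)
  qed
qed

text \<open>If \<open>u\<close> and \<open>v\<close> commute, \<open>v\<close> permutes the fixed
  points of \<open>u\<close>, of which there is only one. If they share a fixed point, their
  nilpotent parts are proportional.\<close>

lemma unipotent2_commute_iff:
  fixes u v :: "'k::field^2^2"
  assumes "unipotent2 u" "u \<noteq> mat 1" "unipotent2 v" "v \<noteq> mat 1"
  shows "u ** v = v ** u \<longleftrightarrow> fixpoint u = fixpoint v"
proof
  assume comm: "u ** v = v ** u"
  have det: "det2 u \<noteq> 0" "det2 v \<noteq> 0" using assms by (auto simp: unipotent2_def)
  have "moebius u (moebius v (fixpoint u)) = moebius v (moebius u (fixpoint u))"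
    using det by (simp add: comm flip: moebius_mult)
  also have "\<dots> = moebius v (fixpoint u)"
    using moebius_unipotent2_eq_iff[OF assms(1,2), of "fixpoint u"] by simp
  finally have "moebius v (fixpoint u) = fixpoint u"
    using moebius_unipotent2_eq_iff[OF assms(1,2)] by simp
  then show "fixpoint u = fixpoint v"
    using moebius_unipotent2_eq_iff[OF assms(3,4)] by simp
next
  assume eq: "fixpoint u = fixpoint v"
  obtain x y z where u: "u = mat2 (1 + x) y z (1 - x)" and *: "x * x + y * z = 0"
    using assms(1) by (rule unipotent2E)
  obtain x' y' z' where v: "v = mat2 (1 + x') y' z' (1 - x')" and **: "x' * x' + y' * z' = 0"
    using assms(3) by (rule unipotent2E)
  show "u ** v = v ** u"
  proof (cases "z = 0")
    case True
    then have "z' = 0" "x = 0" "x' = 0"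
      using eq * ** by (auto simp: fixpoint_def u v split: if_splits)
    then show ?thesis using True by (simp add: u v mat2_mult add.commute)
  next
    case False
    then have z': "z' \<noteq> 0" and xz: "x * z' = x' * z"
      using eq by (auto simp: fixpoint_def u v frac_eq_eq split: if_splits)
    \<comment> \<open>The common fixed point: both nilpotent parts are multiples of the matrix with
      rows (r, -r^2) and (1, -r).\<close>
    define r where "r = x / z"
    have x: "x = r * z" "x' = r * z'"
      using False z' xz by (simp_all add: r_def field_simps)
    have "z * (y + r * r * z) = 0" "z' * (y' + r * r * z') = 0"
      using * ** unfolding x by (simp_all add: algebra_simps)
    then have "y = - (r * r * z)" "y' = - (r * r * z')"
      using False z' by (simp_all add: eq_neg_iff_add_eq_0)
    then show ?thesis by (simp add: u v mat2_mult x algebra_simps)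
  qed
qed

section \<open>Matrix powers and the characteristic\<close>

text \<open>Powers are taken outside the group because they are also needed for
  \<open>u - mat 1\<close>, which need not be invertible.\<close>

primrec matpow :: "'k::semiring_1^2^2 \<Rightarrow> nat \<Rightarrow> 'k^2^2" where
  "matpow M 0 = mat 1"
| "matpow M (Suc n) = matpow M n ** M"

lemma det2_matpow: "det2 (matpow M n) = det2 M ^ n"
  by (induction n) (simp_all add: det2_mult)

text \<open>The nilpotent part N squares to zero, so the binomial expansion stops at 1 + n
  N.\<close>

lemma matpow_unipotent2:
  fixes x y z :: "'k::comm_ring_1"
  assumes "x * x + y * z = 0"
  shows "matpow (mat2 (1 + x) y z (1 - x)) n =
    mat2 (1 + of_nat n * x) (of_nat n * y) (of_nat n * z) (1 - of_nat n * x)"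
proof (induction n)
  case (Suc n)
  have "of_nat n * (x * x) + of_nat n * (y * z) = 0"
    using assms by (simp flip: distrib_left)
  then have "of_nat n * (x * x) = - (of_nat n * (y * z))"
    by (simp add: eq_neg_iff_add_eq_0)
  then show ?case by (simp add: Suc.IH mat2_mult algebra_simps)
qed (simp add: mat_1_eq_mat2)

text \<open>Binomial theorem for the commuting matrices \<open>mat 1\<close> and \<open>N\<close>,
  by Pascal's rule; the entrywise form keeps the binomial coefficients scalars.\<close>

lemma matpow_1_plus:
  fixes N :: "'k::comm_ring_1^2^2"
  shows "matpow (mat 1 + N) n $ i $ j = (\<Sum>k\<le>n. of_nat (n choose k) * matpow N k $ i $ j)"
proof (induction n arbitrary: i j)
  case (Suc n)
  define f where "f k = matpow N k $ i $ j" for k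
  have shift: "(\<Sum>l\<in>UNIV. matpow (mat 1 + N) n $ i $ l * N $ l $ j) =
      (\<Sum>k\<le>n. of_nat (n choose k) * f (Suc k))"
    by (simp add: Suc.IH f_def matrix_matrix_mult_def sum_distrib_left sum_distrib_right
          mult.assoc) (rule sum.swap)
  have "matpow (mat 1 + N) (Suc n) $ i $ j =
      matpow (mat 1 + N) n $ i $ j + (\<Sum>l\<in>UNIV. matpow (mat 1 + N) n $ i $ l * N $ l $ j)"
    by (simp add: matrix_add_ldistrib) (simp add: matrix_matrix_mult_def)
  also have "\<dots> = (\<Sum>k\<le>n. of_nat (n choose k) * f k) + (\<Sum>k\<le>n. of_nat (n choose k) * f (Suc k))"
    by (simp only: shift) (simp add: Suc.IH f_def)
  also have "(\<Sum>k\<le>n. of_nat (n choose k) * f k) = (\<Sum>k\<le>Suc n. of_nat (n choose k) * f k)"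
    by (simp add: binomial_eq_0)
  also have "\<dots> = f 0 + (\<Sum>k\<le>n. of_nat (n choose Suc k) * f (Suc k))"
    by (subst sum.atMost_Suc_shift) simp
  also have "\<dots> + (\<Sum>k\<le>n. of_nat (n choose k) * f (Suc k)) =
      f 0 + (\<Sum>k\<le>n. of_nat (Suc n choose Suc k) * f (Suc k))"
    by (simp add: sum.distrib algebra_simps)
  also have "\<dots> = (\<Sum>k\<le>Suc n. of_nat (Suc n choose k) * f k)"
    by (subst sum.atMost_Suc_shift) simp
  finally show ?case by (simp add: f_def)
qed simp

text \<open>The prime p divides all binomial coefficients strictly between the two ends.\<close>

lemma matpow_1_plus_CHAR:
  fixes N :: "'k::comm_ring_1^2^2"
  assumes "Factorial_Ring.prime CHAR('k)"
  shows "matpow (mat 1 + N) CHAR('k) = mat 1 + matpow N CHAR('k)"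
proof -
  let ?p = "CHAR('k)"
  have p: "?p > 0" using assms prime_gt_0_nat by blast
  have "matpow (mat 1 + N) ?p $ i $ j = (mat 1 + matpow N ?p) $ i $ j" for i j
  proof -
    have "matpow (mat 1 + N) ?p $ i $ j = (\<Sum>k\<in>{0, ?p}. of_nat (?p choose k) * matpow N k $ i $ j)"
      unfolding matpow_1_plus
    proof (rule sum.mono_neutral_right)
      show "\<forall>k\<in>{..?p} - {0, ?p}. of_nat (?p choose k) * matpow N k $ i $ j = 0"
      proof
        fix k assume k: "k \<in> {..?p} - {0, ?p}"
        have "?p dvd (?p choose k)"
          by (rule dvd_choose_prime) (use k assms in auto)
        then have "of_nat (?p choose k) = (0 :: 'k)"
          by (simp only: of_nat_eq_0_iff_char_dvd)
        then show "of_nat (?p choose k) * matpow N k $ i $ j = 0"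
          by simp
      qed
    qed auto
    then show ?thesis using p by simp
  qed
  then show ?thesis by (simp add: vec_eq_iff)
qed

text \<open>Turns a condition on entries into one on the order of \<open>u\<close>, which
  automorphisms respect. If u^p = 1, then N = \<open>u - mat 1\<close> has N^p = 0, so its
  determinant and trace vanish; conversely (1 + N)^p = 1 + p N.\<close>

lemma matpow_CHAR_eq_1_iff:
  fixes u :: "'k::field^2^2"
  assumes prime: "Factorial_Ring.prime CHAR('k)"
  shows "matpow u CHAR('k) = mat 1 \<longleftrightarrow> unipotent2 u"
proof
  let ?p = "CHAR('k)"
  assume pow: "matpow u ?p = mat 1"
  define N where "N = u - mat 1"
  have u: "u = mat 1 + N" by (simp add: N_def)
  have N_pow: "matpow N ?p = 0"
    using pow matpow_1_plus_CHAR[OF prime, of N] by (simp add: u)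
  obtain x y z w where N: "N = mat2 x y z w" by (rule mat2_cases)
  have "det2 N ^ ?p = det2 (matpow N ?p)" by (simp only: det2_matpow)
  also have "\<dots> = 0" by (simp add: N_pow det2_def)
  finally have "det2 N = 0" by (rule power_eq_0_iff[THEN iffD1, THEN conjunct1])
  then have det: "x * w = y * z" by (simp add: N det2_def)
  \<comment> \<open>Cayley-Hamilton with determinant 0: N^2 = (x + w) N.\<close>
  have step: "matpow N (Suc n) = mat2 ((x + w) ^ n * x) ((x + w) ^ n * y) ((x + w) ^ n * z) ((x + w) ^ n * w)" for n
  proof (induction n)
    case 0
    show ?case by (simp add: N mat_1_eq_mat2 mat2_mult)
  next
    case (Suc n)
    have "matpow N (Suc (Suc n)) = matpow N (Suc n) ** N" by (rule matpow.simps)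
    also have "\<dots> = mat2 ((x + w) ^ Suc n * x) ((x + w) ^ Suc n * y) ((x + w) ^ Suc n * z) ((x + w) ^ Suc n * w)"
      unfolding Suc.IH unfolding N mat2_mult using det by (simp add: algebra_simps)
    finally show ?case .
  qed
  obtain n where n: "?p = Suc n" using prime prime_gt_0_nat gr0_implies_Suc by blast
  \<comment> \<open>Either a power of the trace or every entry of \<open>N\<close> is 0; both make
    the trace 0.\<close>
  have "x + w = 0"
    using N_pow[unfolded n step] by (auto simp: mat2_eq_iff)
  then show "unipotent2 u"
    using det by (simp add: unipotent2_def det2_def u N mat_1_eq_mat2 algebra_simps)
next
  assume "unipotent2 u"
  then show "matpow u CHAR('k) = mat 1"
    by (elim unipotent2E) (simp add: matpow_unipotent2 mat_1_eq_mat2)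
qed


section \<open>Subrings of a field and their fractions\<close>

locale field_subring =
  fixes A :: "'k::field set"
  assumes subring: "subring A (ring_of_type_algebra :: 'k ring)"
begin

lemma one_mem: "1 \<in> A"
  and mult_mem: "a \<in> A \<Longrightarrow> b \<in> A \<Longrightarrow> a * b \<in> A"
  and add_mem: "a \<in> A \<Longrightarrow> b \<in> A \<Longrightarrow> a + b \<in> A"
  and zero_mem: "0 \<in> A"
  using subringE(2,3,6,7)[OF subring] by (simp_all add: ring_of_type_algebra_def)

lemma uminus_mem: "a \<in> A \<Longrightarrow> - a \<in> A"
proof -
  assume a: "a \<in> A"
  interpret K: ring "ring_of_type_algebra :: 'k ring" by (rule ring_from_type_algebra)
  have "\<ominus>\<^bsub>ring_of_type_algebra\<^esub> a = - a"
    by (rule K.minus_equality) (simp_all add: ring_of_type_algebra_def)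
  then show "- a \<in> A" using subringE(5)[OF subring a] by simp
qed

lemma diff_mem: "a \<in> A \<Longrightarrow> b \<in> A \<Longrightarrow> a - b \<in> A"
  using add_mem uminus_mem by fastforce

lemma power_mem: "a \<in> A \<Longrightarrow> a ^ n \<in> A"
  by (induction n) (auto intro: one_mem mult_mem)

lemma sum_mem: "(\<And>i. i \<in> I \<Longrightarrow> f i \<in> A) \<Longrightarrow> sum f I \<in> A"
  by (induction I rule: infinite_finite_induct) (auto intro: zero_mem add_mem)

lemma of_nat_mem: "of_nat n \<in> A"
  by (induction n) (auto intro: zero_mem one_mem add_mem)

end

lemma field_subringI:
  assumes "1 \<in> A" "\<And>a. a \<in> A \<Longrightarrow> - a \<in> A"
    and "\<And>a b. a \<in> A \<Longrightarrow> b \<in> A \<Longrightarrow> a + b \<in> A" "\<And>a b. a \<in> A \<Longrightarrow> b \<in> A \<Longrightarrow> a * b \<in> A"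
  shows "field_subring A"
proof (rule field_subring.intro)
  interpret K: ring "ring_of_type_algebra :: 'a ring" by (rule ring_from_type_algebra)
  have "\<ominus>\<^bsub>ring_of_type_algebra\<^esub> a = - a" for a :: 'a
    by (rule K.minus_equality) (simp_all add: ring_of_type_algebra_def)
  then show "subring A (ring_of_type_algebra :: 'a ring)"
    using assms by (intro K.subringI) (simp_all add: ring_of_type_algebra_def)
qed

definition fractions :: "'k::field set \<Rightarrow> 'k set" where
  "fractions A = {a / b | a b. a \<in> A \<and> b \<in> A \<and> b \<noteq> 0}"

lemma fractionsI: "a \<in> A \<Longrightarrow> b \<in> A \<Longrightarrow> b \<noteq> 0 \<Longrightarrow> a / b \<in> fractions A"
  by (auto simp: fractions_def)

lemma fractionsE:
  assumes "x \<in> fractions A"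
  obtains a b where "a \<in> A" "b \<in> A" "b \<noteq> 0" "x = a / b"
  using assms by (auto simp: fractions_def)

context field_subring
begin

lemma subset_fractions: "A \<subseteq> fractions A"
  using fractionsI[OF _ one_mem] by force

lemma generate_field_subset_fractions:
  assumes "H \<subseteq> fractions A"
  shows "generate_field (ring_of_type_algebra :: 'k ring) H \<subseteq> fractions A"
proof
  interpret K: field "ring_of_type_algebra :: 'k ring" by (rule field_from_type_algebra)
  fix h assume "h \<in> generate_field (ring_of_type_algebra :: 'k ring) H"
  then show "h \<in> fractions A"
  proof (induction rule: generate_field.induct)
    case one
    show ?case using subset_fractions one_mem by (auto simp: ring_of_type_algebra_def)
  next
    case (incl h)
    then show ?case using assms by blast
  next
    case (a_inv h)
    then obtain a b where "a \<in> A" "b \<in> A" "b \<noteq> 0" "h = a / b" by (elim fractionsE)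
    moreover have "\<ominus>\<^bsub>ring_of_type_algebra\<^esub> h = - h"
      by (rule K.minus_equality) (simp_all add: ring_of_type_algebra_def)
    ultimately show ?case
      using fractionsI[of "- a" A b] uminus_mem by simp
  next
    case (m_inv h)
    then obtain a b where "a \<in> A" "b \<in> A" "b \<noteq> 0" "h = a / b" by (elim fractionsE)
    moreover from m_inv have "h \<noteq> 0" by (simp add: ring_of_type_algebra_def)
    moreover from this have "inv\<^bsub>ring_of_type_algebra\<^esub> h = inverse h"
      by (intro K.comm_inv_char) (simp_all add: ring_of_type_algebra_def)
    ultimately show ?case
      using fractionsI[of b A a] by simp
  next
    case (eng_add h h')
    then obtain a b a' b' where "a \<in> A" "b \<in> A" "b \<noteq> 0" "h = a / b"
      "a' \<in> A" "b' \<in> A" "b' \<noteq> 0" "h' = a' / b'" by (elim fractionsE)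
    then show ?case
      using fractionsI[of "a * b' + a' * b" A "b * b'"] add_mem mult_mem
      by (simp add: ring_of_type_algebra_def add_frac_eq)
  next
    case (eng_mult h h')
    then obtain a b a' b' where "a \<in> A" "b \<in> A" "b \<noteq> 0" "h = a / b"
      "a' \<in> A" "b' \<in> A" "b' \<noteq> 0" "h' = a' / b'" by (elim fractionsE)
    then show ?case
      using fractionsI[of "a * a'" A "b * b'"] mult_mem
      by (simp add: ring_of_type_algebra_def)
  qed
qed

lemma common_denominator:
  fixes f :: "nat \<Rightarrow> 'k"
  assumes "\<And>i. i \<le> n \<Longrightarrow> f i \<in> fractions A"
  shows "\<exists>d\<in>A. d \<noteq> 0 \<and> (\<forall>i\<le>n. d * f i \<in> A)"
  using assms
proof (induction n)
  case 0
  then obtain a b where "a \<in> A" "b \<in> A" "b \<noteq> 0" "f 0 = a / b"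
    by (meson fractionsE order_refl)
  then show ?case by (intro bexI[of _ b]) auto
next
  case (Suc n)
  then obtain d where d: "d \<in> A" "d \<noteq> 0" "\<forall>i\<le>n. d * f i \<in> A" by auto
  from Suc.prems obtain a b where ab: "a \<in> A" "b \<in> A" "b \<noteq> 0" "f (Suc n) = a / b"
    by (meson fractionsE order_refl)
  have "b * d * f i \<in> A" if "i \<le> Suc n" for i
  proof (cases "i = Suc n")
    case True
    then show ?thesis using ab d mult_mem[of d a] by simp
  next
    case False
    then show ?thesis using d ab that mult_mem[of b "d * f i"] by (simp add: mult.assoc)
  qed
  then show ?case using d ab mult_mem by (intro bexI[of _ "b * d"]) auto
qed

lemma clear_denominators:
  fixes p :: "'k poly"
  assumes "\<And>i. poly.coeff p i \<in> fractions A"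
  obtains d where "d \<in> A" "d \<noteq> 0" "\<And>i. poly.coeff (smult d p) i \<in> A"
proof -
  obtain d where d: "d \<in> A" "d \<noteq> 0" "\<forall>i\<le>Polynomial.degree p. d * poly.coeff p i \<in> A"
    using common_denominator[of "Polynomial.degree p" "poly.coeff p"] assms by auto
  have "poly.coeff (smult d p) i \<in> A" for i
    using d zero_mem by (cases "i \<le> Polynomial.degree p") (auto simp: coeff_eq_0)
  then show thesis using that d by blast
qed

end

section \<open>Integral closure\<close>

text \<open>Closure is meant in the whole field, since it is still to be shown which elements are
  fractions of \<open>A\<close>. The leading term of the monic equation stands alone on the
  left.\<close>

definition integrally_closed :: "'k::field set \<Rightarrow> bool" where
  "integrally_closed A \<longleftrightarrow>
     (\<forall>w n a. (\<forall>i<n. a i \<in> A) \<and> w ^ n = (\<Sum>i<n. a i * w ^ i) \<longrightarrow> w \<in> A)"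

text \<open>Multiplying the root by the leading coefficient \<open>c\<close> of a polynomial over
  \<open>A\<close> makes it integral over \<open>A\<close>, so \<open>c * z\<close> lies in
  \<open>A\<close>.\<close>

lemma (in field_subring) root_mem_fractions:
  fixes p :: "'k poly"
  assumes closed: "integrally_closed A"
    and p: "p \<noteq> 0" "\<And>i. poly.coeff p i \<in> fractions A" and root: "poly p z = 0"
  shows "z \<in> fractions A"
proof -
  obtain d where d: "d \<noteq> 0" "\<And>i. poly.coeff (smult d p) i \<in> A"
    using clear_denominators[OF p(2)] by blast
  define q where "q = smult d p"
  define n where "n = Polynomial.degree q"
  define c where "c = poly.coeff q n"
  have q: "q \<noteq> 0" "\<And>i. poly.coeff q i \<in> A" "poly q z = 0"
    using d p(1) root by (auto simp: q_def)
  have c: "c \<in> A" "c \<noteq> 0" using q by (auto simp: c_def n_def)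
  have "n \<noteq> 0"
  proof
    assume "n = 0"
    then obtain k where "q = [:k:]" unfolding n_def by (rule degree_eq_zeroE)
    with q show False by simp
  qed
  then obtain m where m: "n = Suc m" by (cases n) auto
  have "(\<Sum>i\<le>n. poly.coeff q i * z ^ i) = 0" using q by (simp add: poly_altdef n_def)
  then have lead: "c * z ^ n = - (\<Sum>i<n. poly.coeff q i * z ^ i)"
    by (simp add: lessThan_Suc_atMost[symmetric] c_def eq_neg_iff_add_eq_0 add.commute)
  \<comment> \<open>With \<open>n = Suc m\<close>, the factor \<open>c ^ m\<close> leaves
    \<open>c ^ (m - i)\<close> beside \<open>(c * z) ^ i\<close> for each i \<le> m.\<close>
  have "(c * z) ^ n = c ^ m * (c * z ^ n)" by (simp add: m power_mult_distrib)
  also have "\<dots> = (\<Sum>i<n. - (poly.coeff q i * c ^ (m - i)) * (c * z) ^ i)"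
    unfolding lead sum_distrib_left mult_minus_right sum_negf[symmetric]
  proof (rule sum.cong)
    fix i assume "i \<in> {..<n}"
    then have "c ^ m = c ^ (m - i) * c ^ i" by (simp add: m flip: power_add)
    then show "- (c ^ m * (poly.coeff q i * z ^ i)) = - (poly.coeff q i * c ^ (m - i)) * (c * z) ^ i"
      by (simp add: power_mult_distrib)
  qed simp
  finally have "(c * z) ^ n = (\<Sum>i<n. - (poly.coeff q i * c ^ (m - i)) * (c * z) ^ i)" .
  moreover have "\<forall>i<n. - (poly.coeff q i * c ^ (m - i)) \<in> A"
    using q(2) c(1) by (simp add: uminus_mem mult_mem power_mem)
  ultimately have "c * z \<in> A"
    by (intro closed[unfolded integrally_closed_def, rule_format] conjI)
  then show ?thesis using fractionsI[of "c * z" A c] c by simp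
qed

text \<open>If \<open>w\<close> lay outside \<open>R\<close>, its inverse would lie inside; dividing
  the equation by \<open>w ^ (n - 1)\<close> would write \<open>w\<close> as a polynomial in that
  inverse over \<open>R\<close>.\<close>

lemma integrally_closed_valuation_ring:
  fixes R :: "'k::field set"
  assumes "valuation_ring F R"
  shows "integrally_closed R"
  unfolding integrally_closed_def
proof (intro allI impI, elim conjE)
  fix w :: 'k and n :: nat and a :: "nat \<Rightarrow> 'k"
  assume a: "\<forall>i<n. a i \<in> R" and eq: "w ^ n = (\<Sum>i<n. a i * w ^ i)"
  interpret R: field_subring R
    using assms by (simp add: field_subring_def valuation_ring_def)
  show "w \<in> R"
  proof (rule ccontr)
    assume w: "w \<notin> R"
    then have "w \<noteq> 0" using R.zero_mem by blast
    then have inv: "inverse w \<in> R" using assms w by (auto simp: valuation_ring_def)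
    have "n \<noteq> 0" using eq by (cases n) auto
    then obtain m where m: "n = Suc m" by (cases n) auto
    have "w = w ^ n / w ^ m" using \<open>w \<noteq> 0\<close> by (simp add: m)
    also have "\<dots> = (\<Sum>i<n. a i * inverse w ^ (m - i))"
      unfolding eq sum_divide_distrib
    proof (rule sum.cong)
      fix i assume "i \<in> {..<n}"
      then have "w ^ m = w ^ (m - i) * w ^ i" by (simp add: m flip: power_add)
      then show "a i * w ^ i / w ^ m = a i * inverse w ^ (m - i)"
        using \<open>w \<noteq> 0\<close> by (simp add: field_simps)
    qed simp
    also have "\<dots> \<in> R" using a inv by (auto intro!: R.sum_mem R.mult_mem R.power_mem)
    finally show False using w by contradiction
  qed
qed


section \<open>The ring of elements integral outside a place\<close>

lemma valuation_ring_place_ring: "place F P \<Longrightarrow> valuation_ring F (place_ring P)"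
  using place_ring_eq[of F] by (auto simp: place_def simp del: mem_Collect_eq)

lemma field_subring_integers_outside: "field_subring (integers_outside F P\<^sub>0)"
proof -
  have "field_subring (place_ring P)" if "place F P" for P
    using valuation_ring_place_ring[OF that] by (simp add: field_subring_def valuation_ring_def)
  then show ?thesis
    by (intro field_subringI)
       (auto simp: integers_outside_def intro: field_subring.one_mem field_subring.uminus_mem
          field_subring.add_mem field_subring.mult_mem)
qed

text \<open>An intersection of valuation rings inherits the property.\<close>

lemma integrally_closed_integers_outside: "integrally_closed (integers_outside F P\<^sub>0)"
  using integrally_closed_valuation_ring[OF valuation_ring_place_ring]
  unfolding integrally_closed_def integers_outside_def by (smt (verit) mem_Collect_eq)

lemma constants_subset_integers_outside: "F \<subseteq> integers_outside F P\<^sub>0"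
proof
  fix c assume "c \<in> F"
  then have "c \<in> place_ring P" if "place F P" for P
    using valuation_ring_place_ring[OF that] by (auto simp: valuation_ring_def)
  then show "c \<in> integers_outside F P\<^sub>0" by (simp add: integers_outside_def)
qed


section \<open>Algebraic elements\<close>

lemma nat_pow_ring_of_type_algebra:
  "x [^]\<^bsub>(ring_of_type_algebra :: 'k::field ring)\<^esub> (n::nat) = x ^ n"
proof -
  interpret K: field "ring_of_type_algebra :: 'k ring" by (rule field_from_type_algebra)
  show ?thesis
    by (induction n) (simp_all add: K.nat_pow_Suc, simp_all add: ring_of_type_algebra_def)
qed

text \<open>The lists on the left start with the leading coefficient, those of \<open>Poly\<close>
  with the constant one; hence \<open>rev\<close>.\<close>

lemma eval_ring_of_type_algebra:
  "ring.eval (ring_of_type_algebra :: 'k::field ring) l x = poly (Poly (rev l)) x"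
proof -
  interpret K: field "ring_of_type_algebra :: 'k ring" by (rule field_from_type_algebra)
  show ?thesis
  proof (induction l)
    case Nil
    have "\<zero>\<^bsub>ring_of_type_algebra\<^esub> = (0 :: 'k)" by (simp add: ring_of_type_algebra_def)
    then show ?case by simp
  next
    case (Cons a l)
    have "K.eval (a # l) x = a * x ^ length l + K.eval l x"
      by (simp add: nat_pow_ring_of_type_algebra) (simp add: ring_of_type_algebra_def)
    also have "\<dots> = poly (Poly (rev (a # l))) x"
      by (simp add: Cons.IH Poly_append poly_monom)
    finally show ?case .
  qed
qed

lemma algebraic_ring_of_type_algebra_iff:
  fixes E :: "'k::field set"
  assumes "subring E (ring_of_type_algebra :: 'k ring)"
  shows "ring.algebraic (ring_of_type_algebra :: 'k ring) E x \<longleftrightarrow>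
    (\<exists>p. p \<noteq> 0 \<and> (\<forall>i. poly.coeff p i \<in> E) \<and> poly p x = 0)"
proof -
  interpret K: field "ring_of_type_algebra :: 'k ring" by (rule field_from_type_algebra)
  have carrier: "x \<in> carrier (ring_of_type_algebra :: 'k ring)" for x
    by (simp add: ring_of_type_algebra_def)
  have zero: "\<zero>\<^bsub>ring_of_type_algebra\<^esub> = (0 :: 'k)" by (simp add: ring_of_type_algebra_def)
  have "0 \<in> E" using subringE(2)[OF assms] by (simp add: zero)
  show ?thesis
  proof
    assume "K.algebraic E x"
    then obtain l where l: "l \<in> carrier (E [X]\<^bsub>ring_of_type_algebra\<^esub>)" "l \<noteq> []" "K.eval l x = 0"
      using K.algebraicE[OF assms carrier] unfolding over_def zero by metis
    then have set: "set l \<subseteq> E" and hd: "hd l \<noteq> 0"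
      by (auto simp: univ_poly_def polynomial_def zero)
    have "Poly (rev l) \<noteq> 0"
    proof
      assume "Poly (rev l) = 0"
      then obtain n where "rev l = replicate n 0" by (auto simp: Poly_eq_0)
      then have "set l = set (replicate n 0)" by (metis set_rev)
      then have "set l \<subseteq> {0}" by (auto split: if_splits)
      then show False using hd hd_in_set[OF l(2)] by blast
    qed
    moreover have "poly.coeff (Poly (rev l)) i \<in> E" for i
      using set \<open>0 \<in> E\<close> by (auto simp: nth_default_def) (metis length_rev nth_mem set_rev subsetD)
    ultimately show "\<exists>p. p \<noteq> 0 \<and> (\<forall>i. poly.coeff p i \<in> E) \<and> poly p x = 0"
      using l(3) by (auto simp: eval_ring_of_type_algebra)
  next
    assume "\<exists>p. p \<noteq> 0 \<and> (\<forall>i. poly.coeff p i \<in> E) \<and> poly p x = 0"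
    then obtain p where p: "p \<noteq> 0" "\<forall>i. poly.coeff p i \<in> E" "poly p x = 0" by blast
    have "set (coeffs p) \<subseteq> E" using p(2) by (auto simp: coeffs_def)
    then have "rev (coeffs p) \<in> carrier (E [X]\<^bsub>ring_of_type_algebra\<^esub>)"
      using p(1) by (simp add: univ_poly_def polynomial_def zero hd_rev last_coeffs_eq_coeff_degree)
    then have "(K.algebraic over E) x"
      by (rule K.algebraicI) (use p in \<open>auto simp: zero eval_ring_of_type_algebra\<close>)
    then show "K.algebraic E x" by (simp add: over_def)
  qed
qed

section \<open>Adjoining one element, and the exchange property\<close>

lemma (in field_subring) field_subring_polynomial_values:
  "field_subring {poly p x | p. \<forall>i. poly.coeff p i \<in> A}" (is "field_subring ?B")
proof (rule field_subringI)
  show "1 \<in> ?B"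
    by (rule CollectI, rule exI[of _ 1]) (auto simp: one_mem zero_mem coeff_1)
next
  fix a assume "a \<in> ?B"
  then obtain p where "a = poly p x" "\<forall>i. poly.coeff p i \<in> A" by blast
  then show "- a \<in> ?B"
    by (intro CollectI exI[of _ "- p"]) (auto simp: uminus_mem)
next
  fix a b assume "a \<in> ?B" "b \<in> ?B"
  then obtain p q where pq: "a = poly p x" "b = poly q x"
    and coeffs: "\<forall>i. poly.coeff p i \<in> A" "\<forall>i. poly.coeff q i \<in> A" by blast
  show "a + b \<in> ?B"
    by (rule CollectI, rule exI[of _ "p + q"]) (simp add: pq coeffs add_mem)
  have "\<forall>i. poly.coeff (p * q) i \<in> A"
    unfolding coeff_mult using coeffs by (simp add: sum_mem mult_mem)
  then show "a * b \<in> ?B"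
    by (intro CollectI exI[of _ "p * q"]) (simp add: pq)
qed

text \<open>The exchange property: a relation between \<open>t\<close> and \<open>x\<close> is read as an equation for \<open>x\<close>.\<close>

lemma (in field_subring) algebraic_exchange:
  fixes t x :: 'k
  assumes transcendental: "\<And>p. (\<forall>i. poly.coeff p i \<in> A) \<Longrightarrow> poly p t = 0 \<Longrightarrow> p = 0"
    and P: "P \<noteq> 0" "poly P t = 0"
    and coeffs: "\<And>i. poly.coeff P i \<in> fractions {poly p x | p. \<forall>i. poly.coeff p i \<in> A}"
  obtains B where "B \<noteq> 0" "poly B x = 0"
    "\<And>j. poly.coeff B j \<in> {poly p t | p. \<forall>i. poly.coeff p i \<in> A}"
proof -
  define Ax where "Ax = {poly p x | p. \<forall>i. poly.coeff p i \<in> A}"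
  interpret Ax: field_subring Ax
    unfolding Ax_def by (rule field_subring_polynomial_values)
  obtain d where d: "d \<in> Ax" "d \<noteq> 0" "\<And>i. poly.coeff (smult d P) i \<in> Ax"
    by (rule Ax.clear_denominators[OF coeffs[folded Ax_def]]) (rule that)
  define Q where "Q = smult d P"
  have "Q \<noteq> 0" "poly Q t = 0" using P d by (auto simp: Q_def)
  have "\<forall>i. \<exists>p. poly.coeff Q i = poly p x \<and> (\<forall>j. poly.coeff p j \<in> A)"
    using d(3) by (auto simp: Q_def Ax_def)
  then obtain a where a: "\<And>i. poly.coeff Q i = poly (a i) x" "\<And>i j. poly.coeff (a i) j \<in> A"
    by metis
  define n where "n = Polynomial.degree Q"
  \<comment> \<open>The \<open>a i\<close> are the coefficients of a polynomial in T over A[X] that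
    gives \<open>Q\<close> at X = x. Setting T = t instead gives \<open>B\<close>, while
    \<open>b j\<close> collects the coefficients of X^j as a polynomial in T.\<close>
  define B where "B = (\<Sum>i\<le>n. smult (t ^ i) (a i))"
  define b where "b j = (\<Sum>i\<le>n. Polynomial.monom (poly.coeff (a i) j) i)" for j
  have b: "poly.coeff B j = poly (b j) t" for j
    by (simp add: B_def b_def coeff_sum poly_sum poly_monom mult.commute)
  have coeff_b: "poly.coeff (b j) i = (if i \<le> n then poly.coeff (a i) j else 0)" for i j
    by (simp add: b_def coeff_sum)
  have b_mem: "\<forall>i. poly.coeff (b j) i \<in> A" for j
    by (simp add: coeff_b a(2) zero_mem)
  show thesis
  proof
    show "poly B x = 0"
      using \<open>poly Q t = 0\<close>
      by (simp add: B_def poly_sum poly_altdef[of Q] n_def a(1) mult.commute)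
    show "poly.coeff B j \<in> {poly p t | p. \<forall>i. poly.coeff p i \<in> A}" for j
      using b b_mem by blast
    show "B \<noteq> 0"
    proof
      assume "B = 0"
      \<comment> \<open>Transcendence of \<open>t\<close> kills each \<open>b j\<close>, hence also
        \<open>a n\<close>, which contradicts the choice of \<open>n\<close> as the degree of
        \<open>Q\<close>.\<close>
      then have "b j = 0" for j using b[of j] b_mem transcendental by simp
      then have "poly.coeff (a n) j = 0" for j using coeff_b[of j n] by simp
      then have "a n = 0" by (simp add: poly_eq_iff)
      then have "poly.coeff Q n = 0" by (simp add: a(1))
      then show False using \<open>Q \<noteq> 0\<close> by (simp add: n_def)
    qed
  qed
qed

text \<open>A non-constant \<open>t\<close> is transcendental over the full constant field, so by
  exchange the generator \<open>x\<close> is algebraic over F(t), hence over the fractions of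
  \<open>A\<close>. Integral closedness then brings \<open>x\<close>, and after it the whole field,
  into the fractions.\<close>

lemma fractions_integers_outside:
  fixes F :: "'k::field set"
  assumes "algebraic_function_field F" "full_constant_field F"
    and t: "t \<in> integers_outside F P\<^sub>0" "t \<notin> F"
  shows "fractions (integers_outside F P\<^sub>0) = UNIV"
proof -
  let ?K = "ring_of_type_algebra :: 'k ring"
  define A where "A = integers_outside F P\<^sub>0"
  interpret K: field ?K by (rule field_from_type_algebra)
  interpret A: field_subring A
    unfolding A_def by (rule field_subring_integers_outside)
  have closed: "integrally_closed A"
    unfolding A_def by (rule integrally_closed_integers_outside)
  have FA: "F \<subseteq> A" unfolding A_def by (rule constants_subset_integers_outside)
  obtain x where F: "subfield F ?K"
    and fin: "K.finite_dimension (generate_field ?K (insert x F)) UNIV"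
    using assms(1) by (auto simp: algebraic_function_field_def Let_def)
  interpret F: field_subring F
    by (rule field_subring.intro) (rule subfieldE(1)[OF F])
  have "subfield (generate_field ?K (insert x F)) ?K"
    by (rule K.generate_field_is_subfield) (simp add: ring_of_type_algebra_def)
  note E = this subfieldE(1)[OF this]
  have "subring UNIV ?K" using K.carrier_is_subring by (simp add: ring_of_type_algebra_def)
  then have "(K.algebraic over generate_field ?K (insert x F)) z" for z
    using K.finite_dimension_imp_algebraic[OF E(1) _ fin] by simp
  then have alg: "\<exists>p. p \<noteq> 0 \<and> (\<forall>i. poly.coeff p i \<in> generate_field ?K (insert x F)) \<and> poly p z = 0" for z
    using algebraic_ring_of_type_algebra_iff[OF E(2)] by (simp add: over_def)
  have "x \<in> fractions A"
  proof -
    let ?Fx = "{poly p x | p. \<forall>i. poly.coeff p i \<in> F}"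
    interpret Fx: field_subring ?Fx by (rule F.field_subring_polynomial_values)
    have "x \<in> ?Fx"
      by (rule CollectI, rule exI[of _ "[:0, 1:]"])
         (auto simp: coeff_pCons F.zero_mem F.one_mem split: nat.split)
    moreover have "c \<in> ?Fx" if "c \<in> F" for c
      by (rule CollectI, rule exI[of _ "[:c:]"])
         (auto simp: coeff_pCons F.zero_mem that split: nat.split)
    ultimately have "insert x F \<subseteq> fractions ?Fx"
      using Fx.subset_fractions by blast
    \<comment> \<open>An equation for \<open>t\<close> over F(x), its coefficients read as fractions
      of F[x].\<close>
    from Fx.generate_field_subset_fractions[OF this]
    obtain P where P: "P \<noteq> 0" "poly P t = 0" "\<And>i. poly.coeff P i \<in> fractions ?Fx"
      using alg[of t] by blast
    have "\<not> K.algebraic F t"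
      using assms(2) t(2) by (auto simp: full_constant_field_def)
    then have "p = 0" if "\<forall>i. poly.coeff p i \<in> F" "poly p t = 0" for p
      using algebraic_ring_of_type_algebra_iff[OF F.subring] that by blast
    from F.algebraic_exchange[OF this P]
    obtain B where B: "B \<noteq> 0" "poly B x = 0"
      "\<And>j. poly.coeff B j \<in> {poly p t | p. \<forall>i. poly.coeff p i \<in> F}" by blast
    have "{poly p t | p. \<forall>i. poly.coeff p i \<in> F} \<subseteq> A"
      using FA t(1) by (auto simp: poly_altdef A_def[symmetric] intro!: A.sum_mem A.mult_mem A.power_mem)
    then have "poly.coeff B j \<in> fractions A" for j
      using B(3) A.subset_fractions by blast
    then show ?thesis using A.root_mem_fractions[OF closed B(1) _ B(2)] by blast
  qed
  \<comment> \<open>Second round: F(x) now lies in the fractions, and every element of the field is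
    algebraic over F(x).\<close>
  then have "insert x F \<subseteq> fractions A" using FA A.subset_fractions by blast
  from A.generate_field_subset_fractions[OF this]
  have "z \<in> fractions A" for z
    using alg[of z] A.root_mem_fractions[OF closed] by blast
  then show ?thesis by (auto simp: A_def)
qed

section \<open>Size and characteristic of a function field\<close>

text \<open>Powers of a transcendental element are distinct: a coincidence would make it a root of a
  difference of monomials.\<close>

lemma infinite_function_field:
  assumes "algebraic_function_field (F :: 'k::field set)"
  shows "infinite (UNIV :: 'k set)"
proof
  let ?K = "ring_of_type_algebra :: 'k ring"
  assume fin: "finite (UNIV :: 'k set)"
  interpret K: field ?K by (rule field_from_type_algebra)
  obtain x where F: "subfield F ?K" and x: "K.transcendental F x"
    using assms by (auto simp: algebraic_function_field_def Let_def)
  interpret F: field_subring F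
    by (rule field_subring.intro) (rule subfieldE(1)[OF F])
  have "\<not> inj (\<lambda>n::nat. x ^ n)"
    using fin finite_imageD[of "\<lambda>n. x ^ n" UNIV] finite_subset[OF subset_UNIV] infinite_UNIV_nat by blast
  then obtain m n :: nat where mn: "m \<noteq> n" "x ^ m = x ^ n" by (auto simp: inj_def)
  let ?p = "Polynomial.monom 1 m - Polynomial.monom 1 n :: 'k poly"
  have "poly.coeff ?p m = 1" using mn by simp
  then have "?p \<noteq> 0" by (metis coeff_0 zero_neq_one)
  moreover have "poly.coeff ?p i \<in> F" for i
    by (auto intro!: F.diff_mem F.zero_mem F.one_mem F.uminus_mem)
  moreover have "poly ?p x = 0" using mn by (simp add: poly_monom)
  ultimately show False
    using x algebraic_ring_of_type_algebra_iff[OF F.subring] by blast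
qed

text \<open>The images of the natural numbers lie in the finite \<open>F\<close>, so two coincide
  and the characteristic is positive, hence prime.\<close>

lemma prime_CHAR_function_field:
  assumes "finite F" "algebraic_function_field (F :: 'k::field set)"
  shows "Factorial_Ring.prime CHAR('k)"
proof -
  interpret F: field_subring F
    using assms(2) by (auto simp: field_subring_def algebraic_function_field_def Let_def intro: subfieldE(1))
  have "\<not> inj (of_nat :: nat \<Rightarrow> 'k)"
    using finite_subset[OF _ assms(1)] finite_imageD[of "of_nat :: nat \<Rightarrow> 'k" UNIV] F.of_nat_mem
      infinite_UNIV_nat by blast
  then obtain m n where "m < n" "of_nat m = (of_nat n :: 'k)"
    by (metis injI linorder_neqE_nat)
  then have "CHAR('k) dvd n - m" by (simp add: of_nat_eq_iff_char_dvd)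
  then have "CHAR('k) \<noteq> 0" using \<open>m < n\<close> by (auto intro: ccontr)
  then show ?thesis using prime_CHAR_semidom by blast
qed


section \<open>Automorphisms and the projective line\<close>

lemma mult_GL2 [simp]: "g \<otimes>\<^bsub>GL2 A\<^esub> h = g ** h"
  and one_GL2 [simp]: "\<one>\<^bsub>GL2 A\<^esub> = mat 1"
  by (simp_all add: GL2_def units_of_def M2_def)

lemma carrier_GL2:
  "M \<in> carrier (GL2 A) \<longleftrightarrow>
    (\<forall>i j. M $ i $ j \<in> A) \<and> (\<exists>N. (\<forall>i j. N $ i $ j \<in> A) \<and> N ** M = mat 1 \<and> M ** N = mat 1)"
  by (auto simp: GL2_def units_of_def Units_def M2_def)

lemma det2_GL2: "M \<in> carrier (GL2 A) \<Longrightarrow> det2 M \<noteq> 0"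
  by (metis carrier_GL2 det2_mat_1 det2_mult mult_zero_left zero_neq_one)

lemma moebius_mult_GL2:
  "g \<in> carrier (GL2 A) \<Longrightarrow> h \<in> carrier (GL2 A) \<Longrightarrow> moebius (g ** h) s = moebius g (moebius h s)"
  using moebius_mult det2_GL2 by blast

context field_subring
begin

lemma group_GL2: "group (GL2 A)"
proof -
  have "monoid (M2 A)"
  proof
    fix M N :: "'k^2^2" assume "M \<in> carrier (M2 A)" "N \<in> carrier (M2 A)"
    then show "M \<otimes>\<^bsub>M2 A\<^esub> N \<in> carrier (M2 A)"
      by (auto simp: M2_def matrix_matrix_mult_def intro!: sum_mem mult_mem)
  next
    show "\<one>\<^bsub>M2 A\<^esub> \<in> carrier (M2 A)" by (simp add: M2_def mat_def zero_mem one_mem)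
  qed (simp_all add: M2_def matrix_mul_assoc)
  then show ?thesis unfolding GL2_def by (rule monoid.units_group)
qed

lemma pow_GL2: "g [^]\<^bsub>GL2 A\<^esub> n = matpow g n"
proof -
  interpret G: group "GL2 A" by (rule group_GL2)
  show ?thesis by (induction n) (simp_all add: G.nat_pow_Suc)
qed

lemma unipotent2_mem_GL2:
  assumes "\<And>i j. u $ i $ j \<in> A" "unipotent2 u"
  shows "u \<in> carrier (GL2 A)"
proof -
  obtain x y z where u: "u = mat2 (1 + x) y z (1 - x)" and *: "x * x + y * z = 0"
    using assms(2) by (rule unipotent2E)
  \<comment> \<open>The inverse of 1 + N is 1 - N, as N squares to zero.\<close>
  let ?v = "mat2 (1 - x) (- y) (- z) (1 + x)"
  have "1 + x \<in> A" "y \<in> A" "z \<in> A" "1 - x \<in> A"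
    using assms(1)[of 1 1] assms(1)[of 1 2] assms(1)[of 2 1] assms(1)[of 2 2] by (simp_all add: u)
  then have "\<forall>i j. ?v $ i $ j \<in> A" by (simp add: forall_2 uminus_mem)
  moreover have "x * x = - (y * z)" using * by (simp add: eq_neg_iff_add_eq_0)
  then have "?v ** u = mat 1" "u ** ?v = mat 1"
    by (simp_all add: u mat2_mult mat_1_eq_mat2 algebra_simps)
  ultimately show ?thesis using assms(1) carrier_GL2 by blast
qed

lemma ex_unipotent2_fixpoint:
  assumes "fractions A = UNIV"
  shows "\<exists>u\<in>carrier (GL2 A). unipotent2 u \<and> u \<noteq> mat 1 \<and> fixpoint u = s"
proof (cases s)
  case None
  \<comment> \<open>The summands 0 match the form of \<open>unipotent2_mat2\<close>.\<close>
  let ?u = "mat2 (1 + 0) 1 0 (1 - 0) :: 'k^2^2"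
  have "unipotent2 ?u" by (rule unipotent2_mat2) simp
  moreover have "\<forall>i j. ?u $ i $ j \<in> A" by (simp add: forall_2 zero_mem one_mem)
  ultimately show ?thesis using None
    by (intro bexI[of _ ?u] unipotent2_mem_GL2) (auto simp: fixpoint_def mat_1_eq_mat2)
next
  case (Some r)
  obtain a b where ab: "a \<in> A" "b \<in> A" "b \<noteq> 0" "r = a / b"
    using assms by (metis UNIV_I fractionsE)
  \<comment> \<open>\<open>?u - mat 1\<close> is the column (a, b) times the row (b, -a), so it
    kills the vector (a, b).\<close>
  let ?u = "mat2 (1 + a * b) (- (a * a)) (b * b) (1 - a * b)"
  have "unipotent2 ?u" by (rule unipotent2_mat2) simp
  moreover have "\<forall>i j. ?u $ i $ j \<in> A"
    using ab by (simp add: forall_2 one_mem add_mem diff_mem uminus_mem mult_mem)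
  ultimately show ?thesis using ab Some
    by (intro bexI[of _ ?u] unipotent2_mem_GL2) (auto simp: fixpoint_def mat_1_eq_mat2)
qed

lemma unipotent2_GL2_iff:
  assumes "Factorial_Ring.prime CHAR('k)"
  shows "unipotent2 u \<longleftrightarrow> u [^]\<^bsub>GL2 A\<^esub> CHAR('k) = \<one>\<^bsub>GL2 A\<^esub>"
  using matpow_CHAR_eq_1_iff[OF assms] by (simp add: pow_GL2)

text \<open>A point is represented by the elements of \<open>U\<close> fixing it, and \<tau> sends
  the fixed point of \<open>u\<close> to that of \<open>\<sigma> u\<close>; equivariance comes from
  conjugation.\<close>

lemma automorphism_acts_on_points:
  assumes prime: "Factorial_Ring.prime CHAR('k)" and frac: "fractions A = UNIV"
    and \<sigma>: "\<sigma> \<in> auto (GL2 A)"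
  obtains \<tau> where "bij \<tau>"
    "\<And>g s. g \<in> carrier (GL2 A) \<Longrightarrow> \<tau> (moebius g s) = moebius (\<sigma> g) (\<tau> s)"
proof -
  let ?G = "GL2 A"
  interpret G: group ?G by (rule group_GL2)
  have bij: "bij_betw \<sigma> (carrier ?G) (carrier ?G)"
    and hom: "\<sigma> \<in> hom ?G ?G"
    using \<sigma> by (auto simp: auto_def Bij_def)
  interpret \<sigma>: group_hom ?G ?G \<sigma> by unfold_locales (rule hom)
  have \<sigma>_mult: "\<sigma> (g ** h) = \<sigma> g ** \<sigma> h" if "g \<in> carrier ?G" "h \<in> carrier ?G" for g h
    using \<sigma>.hom_mult[OF that] by simp
  have \<sigma>_inj: "\<sigma> g = \<sigma> h \<longleftrightarrow> g = h" if "g \<in> carrier ?G" "h \<in> carrier ?G" for g h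
    using bij that by (meson bij_betw_imp_inj_on inj_on_eq_iff)
  define U where "U = {u \<in> carrier ?G. unipotent2 u \<and> u \<noteq> mat 1}"
  have U: "u \<in> carrier ?G" "unipotent2 u" "u \<noteq> mat 1" if "u \<in> U" for u
    using that by (auto simp: U_def)
  have \<sigma>_one: "\<sigma> (mat 1) = mat 1" using \<sigma>.hom_one by simp
  have \<sigma>_U: "\<sigma> u \<in> U \<longleftrightarrow> u \<in> U" if u: "u \<in> carrier ?G" for u
  proof -
    have "unipotent2 (\<sigma> u) \<longleftrightarrow> \<sigma> (u [^]\<^bsub>?G\<^esub> CHAR('k)) = \<sigma> \<one>\<^bsub>?G\<^esub>"
      using u by (simp only: unipotent2_GL2_iff[OF prime] \<sigma>.hom_nat_pow \<sigma>.hom_one)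
    also have "\<dots> \<longleftrightarrow> unipotent2 u"
      using u by (simp only: unipotent2_GL2_iff[OF prime] \<sigma>_inj G.nat_pow_closed G.one_closed)
    finally have "unipotent2 (\<sigma> u) \<longleftrightarrow> unipotent2 u" .
    moreover have "\<sigma> u = mat 1 \<longleftrightarrow> u = mat 1"
      using \<sigma>_inj[OF u G.one_closed] \<sigma>_one by simp
    ultimately show ?thesis using u by (auto simp: U_def)
  qed
  have commute: "u ** v = v ** u \<longleftrightarrow> fixpoint u = fixpoint v" if "u \<in> U" "v \<in> U" for u v
    using unipotent2_commute_iff U that by blast
  have fix_\<sigma>: "fixpoint (\<sigma> u) = fixpoint (\<sigma> v) \<longleftrightarrow> fixpoint u = fixpoint v" if "u \<in> U" "v \<in> U" for u v
  proof -
    have "fixpoint (\<sigma> u) = fixpoint (\<sigma> v) \<longleftrightarrow> \<sigma> (u ** v) = \<sigma> (v ** u)"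
      using commute[of "\<sigma> u" "\<sigma> v"] that U(1) by (simp add: \<sigma>_U \<sigma>_mult)
    also have "\<dots> \<longleftrightarrow> u ** v = v ** u"
      using \<sigma>_inj G.m_closed[of u v] G.m_closed[of v u] U that by simp
    finally show ?thesis using commute that by simp
  qed
  \<comment> \<open>Conjugation by \<open>g\<close> moves the fixed point by \<open>g\<close>. The
    conjugate is unipotent because its p-th power is again 1.\<close>
  have conj: "g ** u ** inv\<^bsub>?G\<^esub> g \<in> U \<and> fixpoint (g ** u ** inv\<^bsub>?G\<^esub> g) = moebius g (fixpoint u)"
    if g: "g \<in> carrier ?G" and u: "u \<in> U" for g u
  proof -
    let ?h = "inv\<^bsub>?G\<^esub> g" and ?v = "g ** u ** inv\<^bsub>?G\<^esub> g"
    have closed: "?h \<in> carrier ?G" "?v \<in> carrier ?G" "g ** u \<in> carrier ?G"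
      using g U[OF u] G.m_closed[of g u] G.m_closed[of "g ** u" ?h] by auto
    have inv: "?h ** g = mat 1" "g ** ?h = mat 1"
      using G.l_inv[OF g] G.r_inv[OF g] by auto
    have pow: "matpow ?v n = g ** matpow u n ** ?h" for n
    proof (induction n)
      case (Suc n)
      have "matpow ?v (Suc n) = g ** matpow u n ** (?h ** g) ** u ** ?h"
        by (simp add: Suc.IH matrix_mul_assoc)
      then show ?case by (simp add: inv matrix_mul_assoc)
    qed (simp add: inv)
    have "unipotent2 ?v"
      using U(2)[OF u] unfolding matpow_CHAR_eq_1_iff[OF prime, symmetric]
      by (simp add: pow inv)
    moreover have "?v \<noteq> mat 1"
    proof
      assume "?v = mat 1"
      have "u = (?h ** g) ** u ** (?h ** g)" by (simp add: inv)
      also have "\<dots> = ?h ** ?v ** g" by (simp add: matrix_mul_assoc)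
      also have "\<dots> = mat 1" by (simp add: \<open>?v = mat 1\<close> inv)
      finally show False using U(3)[OF u] by contradiction
    qed
    moreover have "moebius ?v (moebius g (fixpoint u)) = moebius g (fixpoint u)"
    proof -
      have "moebius ?v (moebius g (fixpoint u)) = moebius (?v ** g) (fixpoint u)"
        using moebius_mult_GL2[OF closed(2) g] by simp
      also have "?v ** g = g ** u ** (?h ** g)" by (simp add: matrix_mul_assoc)
      also have "\<dots> = g ** u" by (simp add: inv)
      also have "moebius (g ** u) (fixpoint u) = moebius g (moebius u (fixpoint u))"
        using moebius_mult_GL2[OF g U(1)[OF u]] .
      also have "moebius u (fixpoint u) = fixpoint u"
        using moebius_unipotent2_eq_iff[OF U(2,3)[OF u]] by blast
      finally show ?thesis .
    qed
    ultimately show ?thesis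
      using closed moebius_unipotent2_eq_iff[of ?v] by (auto simp: U_def)
  qed
  have "\<forall>s. \<exists>u\<in>U. fixpoint u = s"
    using ex_unipotent2_fixpoint[OF frac] by (auto simp: U_def)
  then obtain e where e: "\<And>s. e s \<in> U" "\<And>s. fixpoint (e s) = s" by metis
  define \<tau> where "\<tau> s = fixpoint (\<sigma> (e s))" for s
  \<comment> \<open>The value is independent of the representatives chosen by
    \<open>e\<close>.\<close>
  have \<tau>: "\<tau> (fixpoint u) = fixpoint (\<sigma> u)" if "u \<in> U" for u
    unfolding \<tau>_def using fix_\<sigma>[OF e(1) that] e(2) by blast
  show thesis
  proof
    have "s = s'" if "\<tau> s = \<tau> s'" for s s'
      using that fix_\<sigma>[OF e(1) e(1)] e(2) unfolding \<tau>_def by metis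
    moreover have "s \<in> range \<tau>" for s
    proof -
      \<comment> \<open>The preimage of a representative of \<open>s\<close> lies in
        \<open>U\<close> again, and \<tau> sends its fixed point to \<open>s\<close>.\<close>
      obtain u where u: "u \<in> carrier ?G" "\<sigma> u = e s"
        using bij U(1)[OF e(1)[of s]] by (metis bij_betw_imp_surj_on imageE)
      then have "u \<in> U" using \<sigma>_U e(1) by metis
      then show ?thesis using \<tau> u e(2) by (metis rangeI)
    qed
    ultimately show "bij \<tau>" by (auto simp: bij_def inj_def)
  next
    fix g s assume g: "g \<in> carrier ?G"
    let ?h = "inv\<^bsub>?G\<^esub> g"
    have h: "?h \<in> carrier ?G" using g by simp
    have \<sigma>_conj: "\<sigma> (g ** e s ** ?h) = \<sigma> g ** \<sigma> (e s) ** inv\<^bsub>?G\<^esub> (\<sigma> g)"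
      using g h U(1)[OF e(1)[of s]] G.m_closed[of g "e s"] by (simp add: \<sigma>_mult)
    \<comment> \<open>The conjugate of \<open>e s\<close> by \<open>g\<close> represents the point
      \<open>moebius g s\<close>, so \<tau> may be computed from it.\<close>
    have "\<tau> (moebius g s) = fixpoint (\<sigma> (g ** e s ** ?h))"
      using conj[OF g e(1)[of s]] e(2)[of s] \<tau> by metis
    also have "\<dots> = moebius (\<sigma> g) (fixpoint (\<sigma> (e s)))"
      unfolding \<sigma>_conj using conj[of "\<sigma> g" "\<sigma> (e s)"] \<sigma>_U e(1) U(1) g by simp
    finally show "\<tau> (moebius g s) = moebius (\<sigma> g) (\<tau> s)" by (simp add: \<tau>_def)
  qed
qed

end

section \<open>Counting cusps\<close>

lemma Cusp_altdef: "Cusp A H = range (\<lambda>s. (\<lambda>g. moebius g s) ` H)"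
  by (auto simp: Cusp_def orbits_def orbit_def)

text \<open>Taking images under \<tau> sends orbits to orbits, injectively since \<tau> is
  injective.\<close>

lemma cusp_number_equivariant:
  assumes "bij \<tau>" and equivariant: "\<And>g s. g \<in> H \<Longrightarrow> \<tau> (moebius g s) = moebius (\<sigma> g) (\<tau> s)"
  shows "cusp_number A (\<sigma> ` H) = cusp_number A H"
proof -
  have image: "(\<lambda>g. moebius g (\<tau> s)) ` \<sigma> ` H = \<tau> ` (\<lambda>g. moebius g s) ` H" for s
    unfolding image_image by (rule image_cong) (simp_all add: equivariant)
  have "Cusp A (\<sigma> ` H) = (\<lambda>s. (\<lambda>g. moebius g s) ` \<sigma> ` H) ` range \<tau>"
    by (simp only: Cusp_altdef bij_is_surj[OF \<open>bij \<tau>\<close>])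
  also have "\<dots> = range (\<lambda>s. \<tau> ` (\<lambda>g. moebius g s) ` H)"
    unfolding image_image[of _ \<tau> UNIV] by (simp only: image)
  also have "\<dots> = (`) \<tau> ` Cusp A H"
    unfolding Cusp_altdef by (rule image_image[symmetric])
  finally have "Cusp A (\<sigma> ` H) = (`) \<tau> ` Cusp A H" .
  moreover have "inj_on ((`) \<tau>) (Cusp A H)"
    using bij_is_inj[OF \<open>bij \<tau>\<close>] by (simp add: inj_on_def inj_image_eq_iff)
  ultimately show ?thesis by (simp add: card_image cusp_number_def)
qed

text \<open>The orbits of a finite \<open>H\<close> are finite, so finitely many cannot cover the
  infinite projective line; \<open>mat 1\<close> puts each point into its own orbit.\<close>

lemma infinite_Cusp:
  fixes H :: "('k::field^2^2) set"
  assumes "infinite (UNIV :: 'k set)" "finite H" "mat 1 \<in> H"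
  shows "infinite (Cusp A H)"
proof
  assume "finite (Cusp A H)"
  then have "finite (\<Union> (Cusp A H))"
    using assms(2) by (auto simp: Cusp_altdef)
  moreover have "\<Union> (Cusp A H) = UNIV"
  proof (rule UNIV_eq_I[symmetric])
    fix s
    show "s \<in> \<Union> (Cusp A H)"
      using imageI[OF assms(3), of "\<lambda>g. moebius g s"] by (auto simp: Cusp_altdef)
  qed
  ultimately have "finite (UNIV :: 'k option set)" by simp
  then show False using assms(1) by (simp add: finite_option_UNIV)
qed

lemma finite_carrier_GL2:
  assumes "finite A"
  shows "finite (carrier (GL2 A))"
proof (rule finite_subset)
  show "carrier (GL2 A) \<subseteq> (\<lambda>(a, b, c, d). mat2 a b c d) ` (A \<times> A \<times> A \<times> A)"
  proof
    fix M assume "M \<in> carrier (GL2 A)"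
    moreover obtain a b c d where "M = mat2 a b c d" by (rule mat2_cases)
    ultimately show "M \<in> (\<lambda>(a, b, c, d). mat2 a b c d) ` (A \<times> A \<times> A \<times> A)"
      by (force simp: carrier_GL2 forall_2)
  qed
qed (use assms in simp)

theorem theorem1p8:
  fixes F :: "'k::field set" and P\<^sub>0 :: "'k set" and \<sigma> :: "'k^2^2 \<Rightarrow> 'k^2^2"
    and A :: "'k set" and G :: "('k^2^2) monoid" and H :: "('k^2^2) set"
  assumes "finite F"
    and "algebraic_function_field F"
    and "full_constant_field F"
    and "place F P\<^sub>0"
    and "A = integers_outside F P\<^sub>0"
    and "G = GL2 A"
    and "\<sigma> \<in> auto G"
    and "subgroup H G"
    and "finite (rcosets\<^bsub>G\<^esub> H)"
  shows "cusp_number A (\<sigma> ` H) = cusp_number A H"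
proof -
  interpret A: field_subring A
    unfolding assms(5) by (rule field_subring_integers_outside)
  interpret G: group G unfolding assms(6) by (rule A.group_GL2)
  have H: "H \<subseteq> carrier G" "mat 1 \<in> H"
    using subgroup.subset[OF assms(8)] subgroup.one_closed[OF assms(8)] by (simp_all add: assms(6))
  show ?thesis
  proof (cases "A \<subseteq> F")
    case True
    \<comment> \<open>Riemann-Roch excludes this case, but it need not be invoked: \<open>G\<close> would be finite, hence
      both sets of cusps infinite, and the cardinality of an infinite set is 0.\<close>
    then have "finite (carrier G)"
      using finite_carrier_GL2 finite_subset[OF _ assms(1)] by (auto simp: assms(6))
    then have "finite H" using H(1) finite_subset by blast
    have "\<sigma> \<in> hom G G" using assms(7) by (simp add: auto_def)
    then have "\<sigma> (mat 1) = mat 1"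
      using hom_one[OF _ G.group_axioms G.group_axioms] by (simp add: assms(6))
    then have "mat 1 \<in> \<sigma> ` H" using H(2) by force
    then have "infinite (Cusp A H)" "infinite (Cusp A (\<sigma> ` H))"
      using infinite_Cusp[OF infinite_function_field[OF assms(2)]] \<open>finite H\<close> H(2) by blast+
    then show ?thesis by (simp add: cusp_number_def)
  next
    case False
    \<comment> \<open>Here \<open>A\<close> contains a non-constant element, which serves as
      \<open>t\<close>.\<close>
    then have "fractions A = UNIV"
      using fractions_integers_outside[OF assms(2,3)] assms(5) by blast
    then obtain \<tau> where "bij \<tau>"
      "\<And>g s. g \<in> carrier G \<Longrightarrow> \<tau> (moebius g s) = moebius (\<sigma> g) (\<tau> s)"
      using A.automorphism_acts_on_points[OF prime_CHAR_function_field[OF assms(1,2)]] assms(7)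
      unfolding assms(6) by metis
    then show ?thesis using H(1) by (intro cusp_number_equivariant) auto
  qed
qed

end
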